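(* Let $(A,\cdot,\circ)$ be a transposed Novikov-Poisson algebra over $\mathbf{k}$. Then for any fixed elements $p,q$, each lying in $A$ or in $\mathbf{k}$, the triple $(A,\cdot_p,\circ_q)$ is a transposed Novikov-Poisson algebra, where $$x\cdot_p y=p\cdot x\cdot y,\qquad x\circ_q y=x\circ y+q\cdot x\cdot y\qquad\text{for all }x,y\in A.$$
   Context: $\mathbf{k}$ is a field of characteristic not equal to $2$; all binary operations are $\mathbf{k}$-bilinear and algebras need not be unital. If $p\in\mathbf{k}$ then $p\cdot x\cdot y$ means the scalar multiple $p(x\cdot y)$; similarly for $q$. A (left) Novikov algebra $(A,\circ)$ is a vector space with a binary operation satisfying $(x\circ y)\circ z=(x\circ z)\circ y$ and $(x\circ y)\circ z-x\circ(y\circ z)=(y\circ x)\circ z-y\circ(x\circ z)$ for all $x,y,z$. A transposed Novikov-Poisson algebra is a triple $(A,\cdot,\circ)$ where $(A,\cdot)$ is a commutative associative algebra, $(A,\circ)$ is a Novikov algebra, and for all $x,y,z\in A$: $(x\cdot y)\circ z=(x\cdot z)\circ y$ and $2z\cdot(x\circ y)=(z\cdot x)\circ y+x\circ(z\cdot y)$. *)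

theory Defs
  imports Complex_Main
begin

text \<open>All algebras live on a whole type \<open>'a\<close>, made into a vector space over the field \<open>'k\<close> by an
  explicit scalar multiplication. Multiplications are bilinear; no unit is required.\<close>

locale bilinear_algebra = vector_space scale
  for scale :: "'k::field \<Rightarrow> 'a::ab_group_add \<Rightarrow> 'a" (infixr \<open>*s\<close> 75) +
  fixes mult :: "'a \<Rightarrow> 'a \<Rightarrow> 'a" (infixl \<open>\<diamondop>\<close> 70)
  assumes linear_left: "Vector_Spaces.linear scale scale (\<lambda>x. x \<diamondop> y)"
    and linear_right: "Vector_Spaces.linear scale scale (\<lambda>y. x \<diamondop> y)"

locale comm_assoc_algebra = bilinear_algebra scale mult
  for scale :: "'k::field \<Rightarrow> 'a::ab_group_add \<Rightarrow> 'a" (infixr \<open>*s\<close> 75)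
    and mult :: "'a \<Rightarrow> 'a \<Rightarrow> 'a" (infixl \<open>\<cdot>\<close> 70) +
  assumes mult_commute: "x \<cdot> y = y \<cdot> x"
    and mult_assoc: "(x \<cdot> y) \<cdot> z = x \<cdot> (y \<cdot> z)"

locale novikov_algebra = bilinear_algebra scale circ
  for scale :: "'k::field \<Rightarrow> 'a::ab_group_add \<Rightarrow> 'a" (infixr \<open>*s\<close> 75)
    and circ :: "'a \<Rightarrow> 'a \<Rightarrow> 'a" (infixl \<open>\<diamondop>\<close> 70) +
  assumes right_commute: "(x \<diamondop> y) \<diamondop> z = (x \<diamondop> z) \<diamondop> y"
    and left_symmetric:
      "(x \<diamondop> y) \<diamondop> z - x \<diamondop> (y \<diamondop> z) = (y \<diamondop> x) \<diamondop> z - y \<diamondop> (x \<diamondop> z)"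

locale transposed_novikov_poisson =
  dot: comm_assoc_algebra scale dot + circ: novikov_algebra scale circ
  for scale :: "'k::field \<Rightarrow> 'a::ab_group_add \<Rightarrow> 'a" (infixr \<open>*s\<close> 75)
    and dot :: "'a \<Rightarrow> 'a \<Rightarrow> 'a" (infixl \<open>\<cdot>\<close> 70)
    and circ :: "'a \<Rightarrow> 'a \<Rightarrow> 'a" (infixl \<open>\<diamondop>\<close> 70) +
  assumes dot_circ_commute: "(x \<cdot> y) \<diamondop> z = (x \<cdot> z) \<diamondop> y"
    and transposed_compat: "2 *s (z \<cdot> (x \<diamondop> y)) = (z \<cdot> x) \<diamondop> y + x \<diamondop> (z \<cdot> y)"

text \<open>A parameter \<open>p\<close> that is either an algebra element or a scalar is a value of type \<open>'a + 'k\<close>.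
  In both cases \<open>p \<cdot> x \<cdot> y\<close> is rendered as \<open>p\<close> acting on \<open>x \<cdot> y\<close>; for \<open>p\<close> in the algebra the
  bracketing is immaterial, since \<open>\<cdot>\<close> is associative.\<close>

fun act :: "('k \<Rightarrow> 'a \<Rightarrow> 'a) \<Rightarrow> ('a \<Rightarrow> 'a \<Rightarrow> 'a) \<Rightarrow> 'a + 'k \<Rightarrow> 'a \<Rightarrow> 'a" where
  "act scale dot (Inl a) x = dot a x"
| "act scale dot (Inr c) x = scale c x"

definition dot_deform ::
  "('k \<Rightarrow> 'a \<Rightarrow> 'a) \<Rightarrow> ('a \<Rightarrow> 'a \<Rightarrow> 'a) \<Rightarrow> 'a + 'k \<Rightarrow> 'a \<Rightarrow> 'a \<Rightarrow> 'a" where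
  "dot_deform scale dot p x y = act scale dot p (dot x y)"

definition circ_deform ::
  "('k \<Rightarrow> 'a \<Rightarrow> 'a) \<Rightarrow> ('a \<Rightarrow> 'a \<Rightarrow> 'a) \<Rightarrow> ('a \<Rightarrow> 'a \<Rightarrow> 'a::plus) \<Rightarrow> 'a + 'k \<Rightarrow> 'a \<Rightarrow> 'a \<Rightarrow> 'a" where
  "circ_deform scale dot circ q x y = circ x y + act scale dot q (dot x y)"

end

theory Submission
  imports Defs
begin

text \<open>The parameters \<open>p\<close> and \<open>q\<close> enter only through the maps \<open>z \<mapsto> p \<cdot> z\<close> and \<open>z \<mapsto> q \<cdot> z\<close>.
  Whether the parameter is a scalar or an element of the algebra, such a map \<open>T\<close> is a multiplier:
  it is linear and \<open>T (x \<cdot> y) = T x \<cdot> y\<close>. The theorem holds for any two multipliers \<open>P\<close> and \<open>Q\<close>.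
  This treats scalars and elements uniformly, although without a unit a scalar need not act as
  multiplication by an element.

  The point of the multiplier law is that \<open>P (x \<cdot> y)\<close> is again a product, namely of \<open>P x\<close> and \<open>y\<close>,
  so that the two compatibility laws apply to it with \<open>P x\<close> as one of the factors. Two consequences
  of these laws carry the proof. First, \<open>T (x \<cdot> y) \<diamondop> z\<close> is symmetric in all three arguments
  (\<open>multiplier_dot_circ_commute\<close>). Secondly, both terms on the right of
  \<open>2 (z \<cdot> (x \<diamondop> y)) = (z \<cdot> x) \<diamondop> y + x \<diamondop> (z \<cdot> y)\<close> are symmetric in \<open>y\<close> and \<open>z\<close>; as \<open>2\<close> is invertible,
  so is \<open>z \<cdot> (x \<diamondop> y)\<close> (\<open>dot_circ_swap\<close>). Right commutativity of the deformed product follows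
  directly. For left symmetry, the associator of the deformed product differs from the old one by

  \<open>Q (x \<cdot> y) \<diamondop> z + Q (z \<cdot> (x \<diamondop> y)) - x \<diamondop> Q (y \<cdot> z) - Q (x \<cdot> (y \<diamondop> z))\<close>,

  where compatibility and the first symmetry turn \<open>x \<diamondop> Q (y \<cdot> z)\<close> into
  \<open>2 Q (z \<cdot> (x \<diamondop> y)) - Q (x \<cdot> y) \<diamondop> z\<close>, and \<open>dot_circ_swap\<close> turns \<open>Q (x \<cdot> (y \<diamondop> z))\<close> into
  \<open>Q (z \<cdot> (y \<diamondop> x))\<close>. The difference is therefore
  \<open>2 Q (x \<cdot> y) \<diamondop> z - Q (z \<cdot> (x \<diamondop> y)) - Q (z \<cdot> (y \<diamondop> x))\<close>, which is symmetric in \<open>x\<close> and \<open>y\<close>.\<close>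

definition multiplier ::
  "('k::field \<Rightarrow> 'a::ab_group_add \<Rightarrow> 'a) \<Rightarrow> ('a \<Rightarrow> 'a \<Rightarrow> 'a) \<Rightarrow> ('a \<Rightarrow> 'a) \<Rightarrow> bool" where
  "multiplier scale dot T \<longleftrightarrow>
    Vector_Spaces.linear scale scale T \<and> (\<forall>x y. T (dot x y) = dot (T x) y)"

lemma multiplier_linear: "multiplier scale dot T \<Longrightarrow> Vector_Spaces.linear scale scale T"
  and multiplier_dot: "multiplier scale dot T \<Longrightarrow> T (dot x y) = dot (T x) y"
  by (simp_all add: multiplier_def)

lemma two_neq_zero_if_CHAR_neq_2:
  assumes "CHAR('k::field) \<noteq> 2"
  shows "(2::'k) \<noteq> 0"
proof
  assume "(2::'k) = 0"
  then have "CHAR('k) dvd 2"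
    using of_nat_eq_0_iff_char_dvd[where 'a = 'k, of 2] by simp
  then have "CHAR('k) \<le> 2" "CHAR('k) \<noteq> 0"
    by (auto dest: dvd_imp_le intro!: Nat.gr0I)
  moreover have "CHAR('k) \<noteq> 1"
    by simp
  ultimately show False
    using assms by linarith
qed

context comm_assoc_algebra
begin

lemma mult_left_commute: "x \<cdot> (y \<cdot> z) = y \<cdot> (x \<cdot> z)"
  by (metis mult_assoc mult_commute)

lemma linear_add: "Vector_Spaces.linear scale scale T \<Longrightarrow> T (x + y) = T x + T y"
  using module_hom.add[of scale scale T] by (simp add: linear_iff_module_hom)

lemma linear_scale: "Vector_Spaces.linear scale scale T \<Longrightarrow> T (c *s x) = c *s T x"
  using module_hom.scale[of scale scale T] by (simp add: linear_iff_module_hom)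

lemma linearI:
  "(\<And>x y. T (x + y) = T x + T y) \<Longrightarrow> (\<And>c x. T (c *s x) = c *s T x)
    \<Longrightarrow> Vector_Spaces.linear scale scale T"
  by (unfold_locales) auto

lemmas dot_simps =
  linear_add[OF linear_left] linear_add[OF linear_right]
  linear_scale[OF linear_left] linear_scale[OF linear_right]

lemma multiplier_act: "multiplier scale mult (act scale mult p)"
  unfolding multiplier_def
  by (cases p) (auto intro!: linearI simp: dot_simps scale_right_distrib mult_assoc mult.commute)

lemma multiplier_dot_right: "multiplier scale mult T \<Longrightarrow> T (x \<cdot> y) = x \<cdot> T y"
  by (metis multiplier_dot mult_commute)

text \<open>Both composites send \<open>x \<cdot> y\<close> to \<open>T x \<cdot> S y\<close>; on elements that are not products the two
  multipliers need not commute.\<close>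

lemma multipliers_commute_on_products:
  assumes "multiplier scale mult S" "multiplier scale mult T"
  shows "S (T (x \<cdot> y)) = T (S (x \<cdot> y))"
  by (simp add: multiplier_dot[OF assms(2)] multiplier_dot_right[OF assms(1)])

lemma comm_assoc_algebra_deform:
  assumes P: "multiplier scale mult P"
  shows "comm_assoc_algebra scale (\<lambda>x y. P (x \<cdot> y))"
proof (intro comm_assoc_algebra.intro comm_assoc_algebra_axioms.intro
    bilinear_algebra.intro bilinear_algebra_axioms.intro vector_space_axioms)
  note lin = multiplier_linear[OF P]
  fix x y z
  show "Vector_Spaces.linear scale scale (\<lambda>x. P (x \<cdot> y))"
    by (rule linearI) (simp_all add: dot_simps linear_add[OF lin] linear_scale[OF lin])
  show "Vector_Spaces.linear scale scale (\<lambda>y. P (x \<cdot> y))"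
    by (rule linearI) (simp_all add: dot_simps linear_add[OF lin] linear_scale[OF lin])
  show "P (x \<cdot> y) = P (y \<cdot> x)"
    by (simp add: mult_commute)
  show "P (P (x \<cdot> y) \<cdot> z) = P (x \<cdot> P (y \<cdot> z))"
    by (metis P multiplier_dot multiplier_dot_right mult_assoc)
qed

end

context transposed_novikov_poisson
begin

lemmas circ_simps =
  dot.linear_add[OF circ.linear_left] dot.linear_add[OF circ.linear_right]
  dot.linear_scale[OF circ.linear_left] dot.linear_scale[OF circ.linear_right]

lemma multiplier_dot_circ_commute:
  assumes T: "multiplier scale dot T"
  shows "T (x \<cdot> y) \<diamondop> z = T (x \<cdot> z) \<diamondop> y"
    and "T (x \<cdot> y) \<diamondop> z = T (y \<cdot> x) \<diamondop> z"
  using dot_circ_commute by (simp_all add: multiplier_dot[OF T] dot.mult_commute)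

text \<open>Compatibility with the factor \<open>T z\<close>, which by the multiplier law may be rewritten as
  \<open>T\<close> of a product throughout.\<close>

lemma multiplier_compat:
  assumes T: "multiplier scale dot T"
  shows "2 *s T (z \<cdot> (x \<diamondop> y)) = T (z \<cdot> x) \<diamondop> y + x \<diamondop> T (z \<cdot> y)"
  using transposed_compat[of "T z" x y] by (simp add: multiplier_dot[OF T])

lemma dot_circ_swap:
  assumes "(2::'k) \<noteq> 0"
  shows "z \<cdot> (x \<diamondop> y) = y \<cdot> (x \<diamondop> z)"
proof -
  have "2 *s (z \<cdot> (x \<diamondop> y)) = 2 *s (y \<cdot> (x \<diamondop> z))"
    using dot_circ_commute[of x z y]
    by (simp add: transposed_compat dot.mult_commute)
  then show ?thesis
    using assms by simp
qed

lemma novikov_algebra_deform: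
  assumes two: "(2::'k) \<noteq> 0" and Q: "multiplier scale dot Q"
  shows "novikov_algebra scale (\<lambda>x y. x \<diamondop> y + Q (x \<cdot> y))"
proof (intro novikov_algebra.intro novikov_algebra_axioms.intro
    bilinear_algebra.intro bilinear_algebra_axioms.intro dot.vector_space_axioms)
  note lin = multiplier_linear[OF Q]
  note simps = dot.dot_simps circ_simps dot.linear_add[OF lin] dot.linear_scale[OF lin]
    dot.scale_right_distrib
  note comm = multiplier_dot_circ_commute[OF Q]
  fix x y z
  show "Vector_Spaces.linear scale scale (\<lambda>x. x \<diamondop> y + Q (x \<cdot> y))"
    by (rule dot.linearI) (simp_all add: simps)
  show "Vector_Spaces.linear scale scale (\<lambda>y. x \<diamondop> y + Q (x \<cdot> y))"
    by (rule dot.linearI) (simp_all add: simps)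
  have swap: "Q (a \<cdot> (b \<diamondop> c)) = Q (c \<cdot> (b \<diamondop> a))" for a b c
    using dot_circ_swap[OF two] by metis
  have QQ: "Q (Q (a \<cdot> b) \<cdot> c) = Q (Q (a \<cdot> (b \<cdot> c)))" for a b c
    by (metis Q dot.mult_assoc multiplier_dot)
  \<comment> \<open>The two bracketings of a triple product, with the correction terms in the form in which
      their symmetry in the first two arguments can be read off.\<close>
  have left: "(a \<diamondop> b + Q (a \<cdot> b)) \<diamondop> c + Q ((a \<diamondop> b + Q (a \<cdot> b)) \<cdot> c)
      = (a \<diamondop> b) \<diamondop> c + Q (a \<cdot> b) \<diamondop> c + Q (c \<cdot> (a \<diamondop> b)) + Q (Q (a \<cdot> (b \<cdot> c)))" for a b c
    by (simp add: simps QQ dot.mult_commute[of "a \<diamondop> b"] add.assoc)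
  show "(x \<diamondop> y + Q (x \<cdot> y)) \<diamondop> z + Q ((x \<diamondop> y + Q (x \<cdot> y)) \<cdot> z)
      = (x \<diamondop> z + Q (x \<cdot> z)) \<diamondop> y + Q ((x \<diamondop> z + Q (x \<cdot> z)) \<cdot> y)"
    unfolding left
    using circ.right_commute[of x y z] comm(1)[of x y z] swap[of z x y]
    by (simp add: dot.mult_commute)
  have right: "a \<diamondop> (b \<diamondop> c + Q (b \<cdot> c)) + Q (a \<cdot> (b \<diamondop> c + Q (b \<cdot> c)))
      = a \<diamondop> (b \<diamondop> c) + (2 *s Q (c \<cdot> (a \<diamondop> b)) - Q (a \<cdot> b) \<diamondop> c)
        + Q (c \<cdot> (b \<diamondop> a)) + Q (Q (a \<cdot> (b \<cdot> c)))" for a b c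
  proof -
    have "a \<diamondop> Q (b \<cdot> c) = 2 *s Q (c \<cdot> (a \<diamondop> b)) - Q (a \<cdot> b) \<diamondop> c"
      using multiplier_compat[OF Q, of c a b] comm(1)[of a c b]
      by (simp add: dot.mult_commute)
    moreover have "Q (a \<cdot> Q (b \<cdot> c)) = Q (Q (a \<cdot> (b \<cdot> c)))"
      by (simp add: dot.multiplier_dot_right[OF Q])
    ultimately show ?thesis
      by (simp add: simps swap[of a b c] add.assoc)
  qed
  have two_scale: "2 *s v = v + v" for v
    using dot.scale_left_distrib[of 1 1 v] by simp
  show "(x \<diamondop> y + Q (x \<cdot> y)) \<diamondop> z + Q ((x \<diamondop> y + Q (x \<cdot> y)) \<cdot> z)
        - (x \<diamondop> (y \<diamondop> z + Q (y \<cdot> z)) + Q (x \<cdot> (y \<diamondop> z + Q (y \<cdot> z))))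
      = (y \<diamondop> x + Q (y \<cdot> x)) \<diamondop> z + Q ((y \<diamondop> x + Q (y \<cdot> x)) \<cdot> z)
        - (y \<diamondop> (x \<diamondop> z + Q (x \<cdot> z)) + Q (y \<cdot> (x \<diamondop> z + Q (x \<cdot> z))))"
    unfolding left right
    using circ.left_symmetric[of x y z]
    by (simp add: two_scale comm(2)[of y x] dot.mult_left_commute[of y x] algebra_simps)
qed

text \<open>In the two mixed laws the terms coming from \<open>Q\<close> are iterated products, on which \<open>P\<close> and \<open>Q\<close>
  commute; the remaining terms are the original laws with \<open>P\<close> absorbed into one factor.\<close>

lemma transposed_novikov_poisson_deform:
  assumes two: "(2::'k) \<noteq> 0"
    and P: "multiplier scale dot P" and Q: "multiplier scale dot Q"
  shows "transposed_novikov_poisson scale (\<lambda>x y. P (x \<cdot> y)) (\<lambda>x y. x \<diamondop> y + Q (x \<cdot> y))"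
proof (intro transposed_novikov_poisson.intro transposed_novikov_poisson_axioms.intro)
  show "comm_assoc_algebra scale (\<lambda>x y. P (x \<cdot> y))"
    by (rule dot.comm_assoc_algebra_deform[OF P])
  show "novikov_algebra scale (\<lambda>x y. x \<diamondop> y + Q (x \<cdot> y))"
    by (rule novikov_algebra_deform[OF two Q])
  \<comment> \<open>A normal form for iterated products: all factors inside, then \<open>Q\<close>, then \<open>P\<close>.\<close>
  have PQ: "Q (P (a \<cdot> b) \<cdot> c) = P (Q (a \<cdot> (b \<cdot> c)))" for a b c
    by (metis P Q dot.mult_assoc dot.multipliers_commute_on_products multiplier_dot)
  fix x y z
  show "P (x \<cdot> y) \<diamondop> z + Q (P (x \<cdot> y) \<cdot> z) = P (x \<cdot> z) \<diamondop> y + Q (P (x \<cdot> z) \<cdot> y)"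
    using multiplier_dot_circ_commute(1)[OF P, of x y z]
    by (simp add: PQ dot.mult_commute[of y z])
  note lin = multiplier_linear[OF P]
  have "Q (x \<cdot> P (z \<cdot> y)) = P (Q (z \<cdot> (x \<cdot> y)))"
    by (metis PQ dot.mult_commute dot.mult_left_commute)
  moreover have "P (z \<cdot> Q (x \<cdot> y)) = P (Q (z \<cdot> (x \<cdot> y)))"
    by (simp add: dot.multiplier_dot_right[OF Q])
  moreover have "2 *s v = v + v" for v
    using dot.scale_left_distrib[of 1 1 v] by simp
  ultimately show "2 *s P (z \<cdot> (x \<diamondop> y + Q (x \<cdot> y)))
      = P (z \<cdot> x) \<diamondop> y + Q (P (z \<cdot> x) \<cdot> y) + (x \<diamondop> P (z \<cdot> y) + Q (x \<cdot> P (z \<cdot> y)))"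
    using multiplier_compat[OF P, of z x y]
    by (simp add: PQ dot.dot_simps dot.linear_add[OF lin] algebra_simps)
qed

end

theorem theorem2p26:
  fixes scale :: "'k::field \<Rightarrow> 'a::ab_group_add \<Rightarrow> 'a"
    and dot circ :: "'a \<Rightarrow> 'a \<Rightarrow> 'a"
    and p q :: "'a + 'k"
  assumes "CHAR('k) \<noteq> 2"
    and "transposed_novikov_poisson scale dot circ"
  shows "transposed_novikov_poisson scale (dot_deform scale dot p) (circ_deform scale dot circ q)"
proof -
  interpret transposed_novikov_poisson scale dot circ
    by (fact assms(2))
  have "dot_deform scale dot p = (\<lambda>x y. act scale dot p (dot x y))"
    "circ_deform scale dot circ q = (\<lambda>x y. circ x y + act scale dot q (dot x y))"
    by (simp_all add: fun_eq_iff dot_deform_def circ_deform_def)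
  then show ?thesis
    using transposed_novikov_poisson_deform[OF two_neq_zero_if_CHAR_neq_2[OF assms(1)]
        dot.multiplier_act dot.multiplier_act] by simp
qed

end
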